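(* Let $a<b$, $N\ge 2$, and let $a=x_0<x_1<\cdots<x_N=b$ be an arbitrary partition of $[a,b]$. Set $h_\ell=x_\ell-x_{\ell-1}$ for $1\le \ell\le N$ and $d_\iota^\ell=|x_\iota-x_\ell|$ for $0\le \iota,\ell\le N$. For $1\le j\le N-1$ let $\phi_j$ be the hat function on $\mathbb{R}$ given by $\phi_j(x)=(x-x_{j-1})/h_j$ for $x\in(x_{j-1},x_j)$, $\phi_j(x)=(x_{j+1}-x)/h_{j+1}$ for $x\in(x_j,x_{j+1})$, and $\phi_j(x)=0$ elsewhere on $\mathbb{R}$. For $0<s<3/2$ define $$S_{jk}=\int_{\mathbb{R}}|\xi|^{2s}\,\mathscr{F}[\phi_j](\xi)\,\overline{\mathscr{F}[\phi_k](\xi)}\,d\xi,\qquad 1\le j,k\le N-1,$$ where $\mathscr F[u](\xi)=\frac{1}{\sqrt{2\pi}}\int_{\mathbb R}u(x)e^{-\mathrm{i}x\xi}\,dx$. For $1\le l\le N-1$ let $\mathbf c_l=\big(\tfrac1{h_l},\,-\tfrac1{h_l}-\tfrac1{h_{l+1}},\,\tfrac1{h_{l+1}}\big)$ (a row vector). (i) If $s\in(0,3/2)$ and $s\neq 1/2$, then with $\gamma=3-2s$, $$S_{jk}=\widehat C_s\,\mathbf c_j\,\mathbf D_j^k\,\mathbf c_k^{t},\qquad \widehat C_s=\frac{1}{2\,\Gamma(4-2s)\cos(s\pi)},$$ where $\mathbf D_j^k$ is the $3\times 3$ matrix whose $(p,q)$ entry, for $p,q\in\{-1,0,1\}$ (rows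 indexed by $p$, columns by $q$, in the order $-1,0,1$), is $(d_{j+p}^{k+q})^{\gamma}$. (ii) If $s=1/2$, then $$S_{jk}=\frac{1}{2\pi}\,\mathbf c_j\,\mathbf E_j^k\,\mathbf c_k^{t},$$ where $\mathbf E_j^k$ is the $3\times3$ matrix whose $(p,q)$ entry, $p,q\in\{-1,0,1\}$ in the same order, is $(d_{j+p}^{k+q})^2\ln d_{j+p}^{k+q}$, with the convention that this entry is $0$ when $d_{j+p}^{k+q}=0$.
   Context: The quantity $S_{jk}$ is the $(j,k)$ entry of the piecewise-linear finite element stiffness matrix for the integral fractional Laplacian $(-\Delta)^s u=\mathscr F^{-1}[|\xi|^{2s}\mathscr F[u]]$ with homogeneous Dirichlet exterior condition on $\Omega=(a,b)$, i.e. $S_{jk}=\int_{\mathbb R}((-\Delta)^{s/2}\phi_j)((-\Delta)^{s/2}\phi_k)\,dx$. $\mathbf c_k^t$ denotes the transpose (column vector). *)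

theory Defs
  imports "HOL-Analysis.Analysis"
begin

text \<open>Partition nodes are given by a function x :: nat => real, with x 0 = a, x N = b.\<close>

definition mesh :: "(nat \<Rightarrow> real) \<Rightarrow> nat \<Rightarrow> real" where
  "mesh x l = x l - x (l - 1)"

definition dist_nodes :: "(nat \<Rightarrow> real) \<Rightarrow> nat \<Rightarrow> nat \<Rightarrow> real" where
  "dist_nodes x i l = \<bar>x i - x l\<bar>"

definition hat :: "(nat \<Rightarrow> real) \<Rightarrow> nat \<Rightarrow> real \<Rightarrow> real" where
  "hat x j t =
     (if x (j - 1) < t \<and> t < x j then (t - x (j - 1)) / mesh x j
      else if x j < t \<and> t < x (j + 1) then (x (j + 1) - t) / mesh x (j + 1)
      else 0)"

definition fourier :: "(real \<Rightarrow> real) \<Rightarrow> real \<Rightarrow> complex" where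
  "fourier u \<xi> = complex_of_real (1 / sqrt (2 * pi)) *
     integral UNIV (\<lambda>t. complex_of_real (u t) * exp (- \<i> * complex_of_real (t * \<xi>)))"

definition stiff_integrand :: "real \<Rightarrow> (nat \<Rightarrow> real) \<Rightarrow> nat \<Rightarrow> nat \<Rightarrow> real \<Rightarrow> complex" where
  "stiff_integrand s x j k \<xi> =
     complex_of_real (\<bar>\<xi>\<bar> powr (2 * s)) * fourier (hat x j) \<xi> * cnj (fourier (hat x k) \<xi>)"

definition cvec :: "(nat \<Rightarrow> real) \<Rightarrow> nat \<Rightarrow> int \<Rightarrow> real" where
  "cvec x l p =
     (if p = -1 then 1 / mesh x l
      else if p = 0 then - 1 / mesh x l - 1 / mesh x (l + 1)
      else if p = 1 then 1 / mesh x (l + 1) else 0)"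

definition cMc :: "(nat \<Rightarrow> real) \<Rightarrow> nat \<Rightarrow> nat \<Rightarrow> (int \<Rightarrow> int \<Rightarrow> real) \<Rightarrow> real" where
  "cMc x j k M = (\<Sum>p\<in>{-1,0,1::int}. \<Sum>q\<in>{-1,0,1::int}. cvec x j p * M p q * cvec x k q)"

definition Dmat :: "(nat \<Rightarrow> real) \<Rightarrow> real \<Rightarrow> nat \<Rightarrow> nat \<Rightarrow> int \<Rightarrow> int \<Rightarrow> real" where
  "Dmat x \<gamma> j k p q = dist_nodes x (nat (int j + p)) (nat (int k + q)) powr \<gamma>"

definition Emat :: "(nat \<Rightarrow> real) \<Rightarrow> nat \<Rightarrow> nat \<Rightarrow> int \<Rightarrow> int \<Rightarrow> real" where
  "Emat x j k p q =
     (let d = dist_nodes x (nat (int j + p)) (nat (int k + q)) in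
      if d = 0 then 0 else d ^ 2 * ln d)"

definition Chat :: "real \<Rightarrow> real" where
  "Chat s = 1 / (2 * Gamma (4 - 2 * s) * cos (s * pi))"

end

theory Submission
  imports Defs "HOL-Real_Asymp.Real_Asymp"
begin

text \<open>The second derivative of the hat function \<open>\<phi>\<^sub>j\<close> is the combination of point masses at
  \<open>x\<^sub>j\<^sub>-\<^sub>1, x\<^sub>j, x\<^sub>j\<^sub>+\<^sub>1\<close> with weights \<open>c\<^sub>j\<close>, so the stiffness integrand is
  \<open>|\<xi>|\<^bsup>2s-4\<^esup>/(2\<pi>)\<close> times the double sum of \<open>c\<^sub>j\<^sub>p c\<^sub>k\<^sub>q exp (-i d \<xi>)\<close> over the node differences \<open>d\<close>.
  Since the weights annihilate affine functions, any polynomial of degree two in \<open>d\<close> may be added to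
  each exponential; this makes every term integrable on its own. With \<open>\<gamma> = 3 - 2s\<close> the cosine terms are
  homogeneous of degree \<open>\<gamma>\<close> in \<open>d\<close>, and the constant follows from writing \<open>\<xi>\<^bsup>-\<gamma>-1\<^esup>\<close> as a Laplace
  transform and exchanging the integrals, which leaves \<open>\<integral> t\<^bsup>\<gamma>-1\<^esup>/(1+t\<^sup>2) dt\<close>, a Beta integral.
  For \<open>\<gamma> = 2\<close> the correction must be cut off at infinity, which produces the logarithm. The sine
  terms are odd.\<close>

section \<open>Integrals over the positive half-line: transfer, dilation, parity, comparison\<close>

lemma has_integral_Ioi_of_nn_integral:
  fixes f :: "real \<Rightarrow> real"
  assumes [measurable]: "f \<in> borel_measurable borel"
    and nonneg: "\<And>x. x > 0 \<Longrightarrow> 0 \<le> f x"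
    and eq: "(\<integral>\<^sup>+x\<in>{0<..}. ennreal (f x) \<partial>lborel) = ennreal r" and "0 \<le> r"
  shows "(f has_integral r) {0<..}"
proof -
  have "((\<lambda>x. indicator {0<..} x * f x) has_integral r) UNIV"
  proof (rule nn_integral_has_integral)
    have "(\<integral>\<^sup>+x. ennreal (indicator {0<..} x * f x) \<partial>lborel) = (\<integral>\<^sup>+x\<in>{0<..}. ennreal (f x) \<partial>lborel)"
      by (intro nn_integral_cong) (auto simp: indicator_def)
    then show "(\<integral>\<^sup>+x. ennreal (indicator {0<..} x * f x) \<partial>lborel) = ennreal r"
      using eq by simp
  qed (use assms in \<open>auto simp: indicator_def\<close>)
  also have "(\<lambda>x. indicator {0<..} x * f x) = (\<lambda>x. if x \<in> {0<..} then f x else 0)"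
    by (auto simp: indicator_def)
  finally show ?thesis
    by (simp only: has_integral_restrict_UNIV)
qed

lemma has_integral_Ioi_dilate:
  fixes f :: "real \<Rightarrow> real"
  assumes "f absolutely_integrable_on {0<..}" "(f has_integral I) {0<..}" "c > 0"
  shows "(\<lambda>x. f (c * x)) absolutely_integrable_on {0<..}"
    and "((\<lambda>x. f (c * x)) has_integral I / c) {0<..}"
proof -
  have image: "(*) c ` {0<..} = {0<..}"
  proof (intro equalityI subsetI)
    fix y :: real assume "y \<in> {0<..}"
    with \<open>c > 0\<close> show "y \<in> (*) c ` {0<..}"
      by (intro image_eqI[of _ _ "y / c"]) auto
  qed (use \<open>c > 0\<close> in auto)
  have *: "(\<lambda>x. \<bar>c\<bar> * f (c * x)) absolutely_integrable_on {0<..} \<and>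
        integral {0<..} (\<lambda>x. \<bar>c\<bar> * f (c * x)) = I"
    using assms image
    by (subst has_absolute_integral_change_of_variables_1'[where g = "\<lambda>x. c * x"])
       (auto intro!: derivative_eq_intros inj_onI integral_unique)
  then have "((\<lambda>x. c * f (c * x)) has_integral I) {0<..}"
    using \<open>c > 0\<close> by (auto simp: has_integral_iff set_lebesgue_integral_eq_integral(1))
  from has_integral_mult_right[OF this, of "1 / c"]
  show "((\<lambda>x. f (c * x)) has_integral I / c) {0<..}"
    using \<open>c > 0\<close> by simp
  from * show "(\<lambda>x. f (c * x)) absolutely_integrable_on {0<..}"
    using \<open>c > 0\<close> by simp
qed

lemma has_integral_reflect_Ioi:
  fixes f :: "real \<Rightarrow> real"
  assumes "f absolutely_integrable_on {0<..}" "(f has_integral I) {0<..}"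
  shows "((\<lambda>x. f (- x)) has_integral I) {..<0}"
proof -
  have "(\<lambda>x. f (- x)) absolutely_integrable_on {..<0} \<and> integral {..<0} (\<lambda>x. f (- x)) = I"
    using assms by (subst has_absolute_integral_reflect_real[of _ "{0<..}"]) (auto intro: integral_unique)
  then show ?thesis
    by (auto simp: has_integral_iff set_lebesgue_integral_eq_integral(1))
qed

lemma has_integral_UNIV_of_halves:
  fixes f :: "real \<Rightarrow> real"
  assumes "(f has_integral I) {0<..}" "(f has_integral J) {..<0}"
  shows "(f has_integral I + J) UNIV"
proof -
  have disjoint: "{0<..} \<inter> {..<0} = ({} :: real set)"
    by auto
  have "(f has_integral I + J) ({0<..} \<union> {..<0})"
    by (rule has_integral_Un[OF assms]) (simp add: disjoint)
  then have "((\<lambda>x. if x \<in> {0<..} \<union> {..<0} then f x else 0) has_integral I + J) UNIV"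
    by (simp only: has_integral_restrict_UNIV)
  then show ?thesis
    by (rule has_integral_spike[of "{0}", rotated 2]) auto
qed

lemma has_integral_UNIV_even:
  fixes f :: "real \<Rightarrow> real"
  assumes "f absolutely_integrable_on {0<..}" "(f has_integral I) {0<..}" "\<And>x. f (- x) = f x"
  shows "(f has_integral 2 * I) UNIV"
  using has_integral_UNIV_of_halves[OF assms(2), of I] has_integral_reflect_Ioi[OF assms(1,2)]
  by (simp add: assms(3))

lemma has_integral_UNIV_odd:
  fixes f :: "real \<Rightarrow> real"
  assumes "f absolutely_integrable_on {0<..}" "\<And>x. f (- x) = - f x"
  shows "(f has_integral 0) UNIV"
proof -
  define I where "I = integral {0<..} f"
  have I: "(f has_integral I) {0<..}"
    using assms(1) unfolding I_def by (simp add: integrable_integral set_lebesgue_integral_eq_integral(1))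
  have "((\<lambda>x. - f (- x)) has_integral - I) {..<0}"
    by (intro has_integral_neg has_integral_reflect_Ioi assms I)
  then have "(f has_integral - I) {..<0}"
    by (simp add: assms(2))
  from has_integral_UNIV_of_halves[OF I this] show ?thesis
    by simp
qed

text \<open>Comparison with a piecewise power: \<open>a > -1\<close> controls the origin and
  \<open>b < -1\<close> infinity. It serves the signed kernels, whose absolute integrability does
  not follow from a sign.\<close>

lemma absolutely_integrable_on_Ioi_powr_bound:
  fixes f :: "real \<Rightarrow> real"
  assumes "f \<in> borel_measurable borel"
    and "a > -1" "b < -1"
    and near: "\<And>x. 0 < x \<Longrightarrow> x < 1 \<Longrightarrow> \<bar>f x\<bar> \<le> A * x powr a"
    and far: "\<And>x. 1 \<le> x \<Longrightarrow> \<bar>f x\<bar> \<le> B * x powr b"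
  shows "f absolutely_integrable_on {0<..}"
proof -
  define g where "g x = (if x < 1 then A * x powr a else B * x powr b)" for x
  have "g integrable_on {0..1}"
  proof (rule integrable_spike[of "\<lambda>x. A * x powr a" _ "{1}"])
    show "(\<lambda>x. A * x powr a) integrable_on {0..1}"
      using integrable_on_powr_from_0[OF \<open>a > -1\<close>, of 1] by (intro integrable_on_mult_right) auto
  qed (auto simp: g_def)
  moreover have "g integrable_on {1..}"
  proof (rule integrable_eq)
    show "(\<lambda>x. B * x powr b) integrable_on {1..}"
      using has_integral_powr_to_inf[OF \<open>b < -1\<close>, of 1]
      by (intro integrable_on_mult_right) (auto simp: integrable_on_def)
  qed (auto simp: g_def)
  ultimately have "g integrable_on ({0..1} \<union> {1..})"
    by (intro integrable_Un) (auto intro: negligible_subset[of "{1}"])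
  then have g: "g integrable_on {0<..}"
    by (rule integrable_spike_set) (auto intro: negligible_subset[of "{0}"])
  have bound: "norm (f x) \<le> g x" if "x \<in> {0<..}" for x
    using that near[of x] far[of x] by (auto simp: g_def)
  have "f integrable_on {0<..}"
  proof (rule measurable_bounded_by_integrable_imp_integrable[OF _ g bound])
    show "f \<in> borel_measurable (lebesgue_on {0<..})"
      by (intro measurable_restrict_space1 measurable_completion) (use assms in simp)
  qed auto
  then show ?thesis
    using absolutely_integrable_integrable_bound[where f = f and g = g, OF bound _ g] by simp
qed

section \<open>The Beta integral of \<open>t powr (\<gamma> - 1) / (1 + t^2)\<close>\<close>

lemma Gamma_reflection_real:
  fixes x :: real
  shows "Gamma x * Gamma (1 - x) = pi / sin (pi * x)"
proof -
  have "complex_of_real (Gamma x * Gamma (1 - x)) = of_real (pi / sin (pi * x))"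
    using Gamma_reflection_complex[of "of_real x"]
    by (simp add: Gamma_complex_of_real[symmetric] sin_of_real[symmetric])
  then show ?thesis
    using of_real_eq_iff by blast
qed

text \<open>The substitution \<open>u = t^2 / (1 + t^2)\<close> turns the Beta density with
  parameters \<open>\<gamma> / 2\<close> and \<open>1 - \<gamma> / 2\<close> into twice the
  integrand. The parameters add up to 1, so the reflection formula evaluates the Beta value.\<close>

lemma has_integral_powr_over_one_plus_square:
  fixes \<gamma> :: real
  assumes "0 < \<gamma>" "\<gamma> < 2"
  shows "((\<lambda>t. t powr (\<gamma> - 1) / (1 + t\<^sup>2)) has_integral pi / (2 * sin (pi * \<gamma> / 2))) {0<..}"
proof -
  define a where "a = \<gamma> / 2"
  define f where "f u = u powr (a - 1) * (1 - u) powr ((1 - a) - 1)" for u :: real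
  define g where "g t = t\<^sup>2 / (1 + t\<^sup>2)" for t :: real
  have pos: "1 + t\<^sup>2 > 0" for t :: real
    by (simp add: add_pos_nonneg)
  have sub: "1 - g t = 1 / (1 + t\<^sup>2)" for t
    using pos[of t] by (simp add: g_def field_simps)
  have image: "g ` {0<..} = {0<..<1}"
  proof (intro equalityI subsetI)
    fix u :: real assume u: "u \<in> {0<..<1}"
    then have "g (sqrt (u / (1 - u))) = u"
      by (simp add: g_def field_simps)
    with u show "u \<in> g ` {0<..}"
      by (intro image_eqI[of _ _ "sqrt (u / (1 - u))"]) auto
  qed (use pos in \<open>auto simp: g_def field_simps\<close>)
  have inj: "inj_on g {0<..}"
  proof (rule inj_onI)
    fix s t assume st: "s \<in> {0<..}" "t \<in> {0<..}" "g s = g t"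
    then have "1 / (1 + s\<^sup>2) = 1 / (1 + t\<^sup>2)"
      by (metis sub)
    then have "s\<^sup>2 = t\<^sup>2"
      using pos[of s] pos[of t] by simp
    with st show "s = t"
      by (auto simp: power2_eq_iff)
  qed
  have "(f has_integral Beta a (1 - a)) {0..1}"
    unfolding f_def by (rule has_integral_Beta_real) (use assms in \<open>auto simp: a_def\<close>)
  then have f: "(f has_integral Beta a (1 - a)) {0<..<1}"
    by (simp add: has_integral_Icc_iff_Ioo)
  moreover have "f absolutely_integrable_on {0<..<1}"
    by (rule nonnegative_absolutely_integrable_1) (use f in \<open>auto simp: f_def integrable_on_def\<close>)
  ultimately have "(\<lambda>t. \<bar>2 * t / (1 + t\<^sup>2)\<^sup>2\<bar> * f (g t)) absolutely_integrable_on {0<..} \<and>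
        integral {0<..} (\<lambda>t. \<bar>2 * t / (1 + t\<^sup>2)\<^sup>2\<bar> * f (g t)) = Beta a (1 - a)"
    using image inj
    apply (subst has_absolute_integral_change_of_variables_1'[where g = g])
    subgoal by simp
    subgoal for t
      unfolding g_def using pos[of t]
      by (auto intro!: derivative_eq_intros simp: power2_eq_square) (simp add: field_simps)
    by (auto intro: integral_unique)
  then have "((\<lambda>t. \<bar>2 * t / (1 + t\<^sup>2)\<^sup>2\<bar> * f (g t)) has_integral Beta a (1 - a)) {0<..}"
    by (auto simp: has_integral_iff set_lebesgue_integral_eq_integral(1))
  from has_integral_mult_right[OF this, of "1 / 2"]
  have "((\<lambda>t. t powr (\<gamma> - 1) / (1 + t\<^sup>2)) has_integral 1 / 2 * Beta a (1 - a)) {0<..}"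
  proof (rule has_integral_eq[rotated])
    fix t :: real assume t: "t \<in> {0<..}"
    define w where "w = 1 + t\<^sup>2"
    have w: "w > 0" using pos by (simp add: w_def)
    \<comment> \<open>Since \<open>g t = t^2 / w\<close> and \<open>1 - g t = 1 / w\<close>, and the
      two Beta exponents add up to -1, the powers of \<open>w\<close> combine to
      \<open>w powr 1\<close>.\<close>
    have "f (g t) = (t\<^sup>2) powr (a - 1) * w powr (1 - a) * w powr a"
      using t w unfolding f_def sub
      unfolding g_def w_def[symmetric]
      by (simp add: powr_divide powr_minus_divide powr_diff field_simps)
    also have "\<dots> = (t powr 2) powr (a - 1) * w powr 1"
      using t by (simp add: powr_add[symmetric] mult.assoc)
    also have "\<dots> = t powr (\<gamma> - 2) * w"
      using w by (simp add: powr_powr a_def algebra_simps)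
    finally have "1 / 2 * (\<bar>2 * t / w\<^sup>2\<bar> * f (g t)) = (t powr (\<gamma> - 2) * t powr 1) / w"
      using t w by (simp add: power2_eq_square)
    then show "1 / 2 * (\<bar>2 * t / (1 + t\<^sup>2)\<^sup>2\<bar> * f (g t)) = t powr (\<gamma> - 1) / (1 + t\<^sup>2)"
      unfolding w_def by (simp only: powr_add[symmetric]) simp
  qed
  then show ?thesis
    using Gamma_reflection_real[of a] by (simp add: Beta_def a_def mult.commute)
qed

section \<open>Mellin integrals through Laplace transforms\<close>

lemma nn_integral_Ici_eq_Ioi:
  fixes f :: "real \<Rightarrow> ennreal"
  shows "(\<integral>\<^sup>+x\<in>{0..}. f x \<partial>lborel) = (\<integral>\<^sup>+x\<in>{0<..}. f x \<partial>lborel)"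
proof (rule nn_integral_cong_AE)
  show "AE x in lborel. f x * indicator {0..} x = f x * indicator {0<..} x"
    using AE_lborel_singleton[of 0] by eventually_elim (auto simp: indicator_def)
qed

text \<open>Euler's Gamma integral dilated by \<open>x\<close>, in the \<open>nn_integral\<close>
  form on which the exchange of integrals operates.\<close>

lemma nn_integral_powr_exp:
  fixes \<gamma> x :: real
  assumes "\<gamma> > -1" "x > 0"
  shows "(\<integral>\<^sup>+t\<in>{0<..}. ennreal (t powr \<gamma> * exp (- (t * x))) \<partial>lborel) =
    ennreal (Gamma (\<gamma> + 1) * x powr (- \<gamma> - 1))"
proof -
  define f where "f t = t powr \<gamma> / exp t" for t :: real
  have "(f has_integral Gamma (\<gamma> + 1)) {0..}"
    using Gamma_integral_real[of "\<gamma> + 1"] assms by (simp add: f_def[abs_def])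
  then have "((\<lambda>t. if t \<in> {0<..} then f t else 0) has_integral Gamma (\<gamma> + 1)) {0..}"
    by (rule has_integral_spike[of "{0}", rotated 2]) auto
  then have f: "(f has_integral Gamma (\<gamma> + 1)) {0<..}"
    by (subst (asm) has_integral_restrict) auto
  have "f absolutely_integrable_on {0<..}"
    by (rule nonnegative_absolutely_integrable_1) (use f in \<open>auto simp: f_def integrable_on_def\<close>)
  from has_integral_Ioi_dilate(2)[OF this f \<open>x > 0\<close>]
  have "((\<lambda>t. x powr (- \<gamma>) * f (x * t)) has_integral x powr (- \<gamma>) * (Gamma (\<gamma> + 1) / x)) {0<..}"
    by (rule has_integral_mult_right)
  also have "x powr (- \<gamma>) * (Gamma (\<gamma> + 1) / x) = Gamma (\<gamma> + 1) * x powr (- \<gamma> - 1)"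
    using assms by (simp add: powr_diff)
  finally have "((\<lambda>t. t powr \<gamma> * exp (- (t * x))) has_integral Gamma (\<gamma> + 1) * x powr (- \<gamma> - 1)) {0<..}"
  proof (rule has_integral_eq[rotated])
    fix t :: real assume "t \<in> {0<..}"
    then show "x powr (- \<gamma>) * f (x * t) = t powr \<gamma> * exp (- (t * x))"
      using assms by (simp add: f_def powr_mult powr_minus exp_minus field_simps)
  qed
  then show ?thesis
    by (rule nn_integral_has_integral_lebesgue'[rotated]) auto
qed

text \<open>Since \<open>\<Gamma>(\<gamma>+1) x\<^bsup>-\<gamma>-1\<^esup>\<close> is the Laplace transform of \<open>t\<^bsup>\<gamma>\<^esup>\<close>, Tonelli turns a Mellin
  integral of \<open>g\<close> into one of its Laplace transform \<open>L\<close>.\<close>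

lemma has_integral_powr_mult_via_Laplace:
  fixes g L :: "real \<Rightarrow> real"
  assumes "\<gamma> > -1"
    and [measurable]: "g \<in> borel_measurable borel"
    and g_nonneg: "\<And>x. 0 \<le> g x"
    and L_nonneg: "\<And>t. t > 0 \<Longrightarrow> 0 \<le> L t"
    and L: "\<And>t. t > 0 \<Longrightarrow> (\<integral>\<^sup>+x\<in>{0<..}. ennreal (exp (- (t * x)) * g x) \<partial>lborel) = ennreal (L t)"
    and I: "((\<lambda>t. t powr \<gamma> * L t) has_integral I) {0<..}"
  shows "((\<lambda>x. x powr (- \<gamma> - 1) * g x) has_integral I / Gamma (\<gamma> + 1)) {0<..}"
proof (rule has_integral_Ioi_of_nn_integral)
  define G where "G = Gamma (\<gamma> + 1)"
  have G: "G > 0"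
    using assms(1) by (simp add: G_def)
  \<comment> \<open>The joint integrand on the open quadrant: integrating out \<open>t\<close> gives
    \<open>G\<close> times the wanted Mellin integrand, integrating out \<open>x\<close> gives
    \<open>t powr \<gamma> * L t\<close>.\<close>
  define h where "h x t = ennreal (t powr \<gamma> * exp (- (t * x)) * g x) * indicator {0<..} x * indicator {0<..} t"
    for x t :: real
  have [measurable]: "case_prod h \<in> borel_measurable (lborel \<Otimes>\<^sub>M lborel)"
    unfolding h_def by measurable
  have "ennreal G * (\<integral>\<^sup>+x\<in>{0<..}. ennreal (x powr (- \<gamma> - 1) * g x) \<partial>lborel) =
        (\<integral>\<^sup>+x. ennreal G * (ennreal (x powr (- \<gamma> - 1) * g x) * indicator {0<..} x) \<partial>lborel)"
    by (rule nn_integral_cmult[symmetric]) measurable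
  also have "\<dots> = (\<integral>\<^sup>+x. \<integral>\<^sup>+t. h x t \<partial>lborel \<partial>lborel)"
  proof (rule nn_integral_cong)
    fix x :: real
    show "ennreal G * (ennreal (x powr (- \<gamma> - 1) * g x) * indicator {0<..} x) = (\<integral>\<^sup>+t. h x t \<partial>lborel)"
    proof (cases "x > 0")
      case True
      have "(\<integral>\<^sup>+t. h x t \<partial>lborel) =
        (\<integral>\<^sup>+t. ennreal (g x) * (ennreal (t powr \<gamma> * exp (- (t * x))) * indicator {0<..} t) \<partial>lborel)"
        using True g_nonneg[of x]
        by (intro nn_integral_cong) (auto simp: h_def indicator_def ennreal_mult[symmetric] mult_ac)
      also have "\<dots> = ennreal (g x) * ennreal (G * x powr (- \<gamma> - 1))"
        unfolding G_def nn_integral_powr_exp[OF assms(1) True, symmetric]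
        by (rule nn_integral_cmult) measurable
      finally show ?thesis
        using True G g_nonneg[of x] by (simp add: ennreal_mult[symmetric] mult_ac)
    qed (simp add: h_def)
  qed
  also have "\<dots> = (\<integral>\<^sup>+t. \<integral>\<^sup>+x. h x t \<partial>lborel \<partial>lborel)"
    by (rule lborel_pair.Fubini'[symmetric]) measurable
  also have "\<dots> = (\<integral>\<^sup>+t\<in>{0<..}. ennreal (t powr \<gamma> * L t) \<partial>lborel)"
  proof (rule nn_integral_cong)
    fix t :: real
    show "(\<integral>\<^sup>+x. h x t \<partial>lborel) = ennreal (t powr \<gamma> * L t) * indicator {0<..} t"
    proof (cases "t > 0")
      case True
      have "(\<integral>\<^sup>+x. h x t \<partial>lborel) =
        (\<integral>\<^sup>+x. ennreal (t powr \<gamma>) * (ennreal (exp (- (t * x)) * g x) * indicator {0<..} x) \<partial>lborel)"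
        using True g_nonneg
        by (intro nn_integral_cong) (auto simp: h_def indicator_def ennreal_mult[symmetric] mult_ac)
      also have "\<dots> = ennreal (t powr \<gamma>) * ennreal (L t)"
        unfolding L[OF True, symmetric] by (rule nn_integral_cmult) measurable
      finally show ?thesis
        using True L_nonneg by (simp add: ennreal_mult)
    qed (simp add: h_def)
  qed
  also have "\<dots> = ennreal I"
    by (rule nn_integral_has_integral_lebesgue'[OF _ I]) (use L_nonneg in auto)
  finally have eq: "ennreal G * (\<integral>\<^sup>+x\<in>{0<..}. ennreal (x powr (- \<gamma> - 1) * g x) \<partial>lborel) = ennreal I" .
  have "I \<ge> 0"
    by (rule has_integral_nonneg[OF I]) (use L_nonneg in auto)
  then show "0 \<le> I / Gamma (\<gamma> + 1)"
    using G by (simp add: G_def)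
  have "(\<integral>\<^sup>+x\<in>{0<..}. ennreal (x powr (- \<gamma> - 1) * g x) \<partial>lborel) =
      ennreal (1 / G) * (ennreal G * (\<integral>\<^sup>+x\<in>{0<..}. ennreal (x powr (- \<gamma> - 1) * g x) \<partial>lborel))"
    using G by (simp add: mult.assoc[symmetric] ennreal_mult[symmetric])
  then show "(\<integral>\<^sup>+x\<in>{0<..}. ennreal (x powr (- \<gamma> - 1) * g x) \<partial>lborel) = ennreal (I / Gamma (\<gamma> + 1))"
    unfolding eq using G \<open>I \<ge> 0\<close> by (simp add: ennreal_mult[symmetric] G_def)
qed (use g_nonneg in auto)

section \<open>Mellin integrals of the cosine remainders\<close>

text \<open>The Laplace transform of \<open>1 - cos x\<close> is
  \<open>1/t - t/(1 + t^2) = 1/(t * (1 + t^2))\<close>, so multiplying by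
  \<open>t powr \<gamma>\<close> gives the Beta integrand.\<close>

lemma has_integral_powr_one_minus_cos:
  fixes \<gamma> :: real
  assumes "0 < \<gamma>" "\<gamma> < 2"
  shows "((\<lambda>x. x powr (- \<gamma> - 1) * (1 - cos x)) has_integral
    pi / (2 * sin (pi * \<gamma> / 2)) / Gamma (\<gamma> + 1)) {0<..}"
proof (rule has_integral_powr_mult_via_Laplace)
  have pos: "1 + t\<^sup>2 > 0" for t :: real
    by (simp add: add_pos_nonneg)
  show "(\<integral>\<^sup>+x\<in>{0<..}. ennreal (exp (- (t * x)) * (1 - cos x)) \<partial>lborel) = ennreal (1 / (t * (1 + t\<^sup>2)))"
    if t: "t > 0" for t :: real
  proof -
    \<comment> \<open>An antiderivative that vanishes at infinity, so the Laplace integral equals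
      \<open>- F 0\<close>.\<close>
    define F where "F x = - exp (- (t * x)) / t - exp (- (t * x)) * (sin x - t * cos x) / (1 + t\<^sup>2)" for x
    have lim: "(F \<longlongrightarrow> 0) at_top"
    proof (rule Lim_null_comparison)
      show "\<forall>\<^sub>F x in at_top. norm (F x) \<le> exp (- (t * x)) * (1 / t + (1 + t) / (1 + t\<^sup>2))"
      proof (intro always_eventually allI)
        fix x :: real
        have "\<bar>t * cos x\<bar> \<le> t * 1"
          unfolding abs_mult using t by (intro mult_mono) auto
        then have "\<bar>sin x - t * cos x\<bar> \<le> 1 + t"
          using abs_sin_le_one[of x] by linarith
        then have "\<bar>(sin x - t * cos x) / (1 + t\<^sup>2)\<bar> \<le> (1 + t) / (1 + t\<^sup>2)"
          using pos[of t] by (simp add: divide_right_mono)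
        then have "\<bar>1 / t + (sin x - t * cos x) / (1 + t\<^sup>2)\<bar> \<le> 1 / t + (1 + t) / (1 + t\<^sup>2)"
          using t by (intro abs_triangle_ineq[THEN order_trans]) simp
        moreover have "F x = exp (- (t * x)) * - (1 / t + (sin x - t * cos x) / (1 + t\<^sup>2))"
          by (simp add: F_def algebra_simps)
        ultimately show "norm (F x) \<le> exp (- (t * x)) * (1 / t + (1 + t) / (1 + t\<^sup>2))"
          by (simp only: real_norm_def abs_mult abs_minus_cancel abs_exp_cancel) simp
      qed
      show "((\<lambda>x. exp (- (t * x)) * (1 / t + (1 + t) / (1 + t\<^sup>2))) \<longlongrightarrow> 0) at_top"
      proof (rule tendsto_mult_left_zero)
        show "((\<lambda>x. exp (- (t * x))) \<longlongrightarrow> 0) at_top"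
          using t by real_asymp
      qed
    qed
    have "(\<integral>\<^sup>+x\<in>{0..}. ennreal (exp (- (t * x)) * (1 - cos x)) \<partial>lborel) = ennreal (0 - F 0)"
    proof (rule nn_integral_FTC_atLeast[OF _ _ _ lim])
      fix x :: real
      show "DERIV F x :> exp (- (t * x)) * (1 - cos x)"
        unfolding F_def using t pos[of t]
        by (auto intro!: derivative_eq_intros) (simp add: field_simps power2_eq_square)
    qed auto
    also have "0 - F 0 = 1 / (t * (1 + t\<^sup>2))"
      using t pos[of t] by (simp add: F_def field_simps power2_eq_square)
    finally show ?thesis
      by (simp only: nn_integral_Ici_eq_Ioi)
  qed
  show "((\<lambda>t. t powr \<gamma> * (1 / (t * (1 + t\<^sup>2)))) has_integral pi / (2 * sin (pi * \<gamma> / 2))) {0<..}"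
    using has_integral_powr_over_one_plus_square[OF assms]
    by (rule has_integral_eq[rotated]) (auto simp: powr_diff)
qed (use assms in \<open>auto intro!: divide_nonneg_pos mult_pos_pos add_pos_nonneg\<close>)

text \<open>Half-angle formula and \<open>|sin y| \<le> |y|\<close>. It supplies the nonnegativity
  that the Tonelli argument asks of the Taylor-corrected kernel.\<close>

lemma cos_ge_one_minus_half_square: "1 - x\<^sup>2 / 2 \<le> cos x" for x :: real
proof -
  have "(sin (x / 2))\<^sup>2 \<le> (x / 2)\<^sup>2"
    using abs_sin_x_le_abs_x[of "x / 2"] by (simp only: abs_le_square_iff)
  moreover have "cos x = 1 - 2 * (sin (x / 2))\<^sup>2"
    using cos_double_sin[of "x / 2"] by simp
  ultimately show ?thesis
    by (simp add: power_divide)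
qed

text \<open>Beyond \<gamma> = 2 the quadratic Taylor term must be removed at 0 as well. Now the
  Laplace transform is \<open>t/(1 + t^2) - 1/t + 1/t^3 = 1/(t^3 * (1 + t^2))\<close>, which leads
  back to the Beta integral with \<open>\<gamma> - 2\<close> for \<gamma>.\<close>

lemma has_integral_powr_cos_minus_Taylor:
  fixes \<gamma> :: real
  assumes "2 < \<gamma>" "\<gamma> < 4"
  shows "((\<lambda>x. x powr (- \<gamma> - 1) * (cos x - 1 + x\<^sup>2 / 2)) has_integral
    - (pi / (2 * sin (pi * \<gamma> / 2))) / Gamma (\<gamma> + 1)) {0<..}"
proof (rule has_integral_powr_mult_via_Laplace)
  have pos: "1 + t\<^sup>2 > 0" for t :: real
    by (simp add: add_pos_nonneg)
  show nonneg: "0 \<le> cos x - 1 + x\<^sup>2 / 2" for x :: real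
    using cos_ge_one_minus_half_square[of x] by simp
  show "(\<integral>\<^sup>+x\<in>{0<..}. ennreal (exp (- (t * x)) * (cos x - 1 + x\<^sup>2 / 2)) \<partial>lborel) =
      ennreal (1 / (t ^ 3 * (1 + t\<^sup>2)))"
    if t: "t > 0" for t :: real
  proof -
    define F where "F x = exp (- (t * x)) * ((sin x - t * cos x) / (1 + t\<^sup>2) + 1 / t
      - x\<^sup>2 / (2 * t) - x / t\<^sup>2 - 1 / t ^ 3)" for x
    have lim: "(F \<longlongrightarrow> 0) at_top"
    proof (rule Lim_null_comparison)
      show "\<forall>\<^sub>F x in at_top. norm (F x) \<le> exp (- (t * x)) *
        ((1 + t) / (1 + t\<^sup>2) + 1 / t + x\<^sup>2 / (2 * t) + x / t\<^sup>2 + 1 / t ^ 3)"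
        using eventually_ge_at_top[of 0]
      proof eventually_elim
        case (elim x)
        have "\<bar>t * cos x\<bar> \<le> t * 1"
          unfolding abs_mult using t by (intro mult_mono) auto
        then have "\<bar>sin x - t * cos x\<bar> \<le> 1 + t"
          using abs_sin_le_one[of x] by linarith
        then have "\<bar>(sin x - t * cos x) / (1 + t\<^sup>2)\<bar> \<le> (1 + t) / (1 + t\<^sup>2)"
          using pos[of t] by (simp add: divide_right_mono)
        moreover have "1 / t \<ge> 0" "x\<^sup>2 / (2 * t) \<ge> 0" "x / t\<^sup>2 \<ge> 0" "1 / t ^ 3 \<ge> 0"
          using t elim by auto
        ultimately have "\<bar>(sin x - t * cos x) / (1 + t\<^sup>2) + 1 / t - x\<^sup>2 / (2 * t) - x / t\<^sup>2 - 1 / t ^ 3\<bar>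
            \<le> (1 + t) / (1 + t\<^sup>2) + 1 / t + x\<^sup>2 / (2 * t) + x / t\<^sup>2 + 1 / t ^ 3"
          by linarith
        then show ?case
          by (simp only: F_def real_norm_def abs_mult abs_exp_cancel) simp
      qed
      show "((\<lambda>x. exp (- (t * x)) *
        ((1 + t) / (1 + t\<^sup>2) + 1 / t + x\<^sup>2 / (2 * t) + x / t\<^sup>2 + 1 / t ^ 3)) \<longlongrightarrow> 0) at_top"
        using t by real_asymp
    qed
    have "(\<integral>\<^sup>+x\<in>{0..}. ennreal (exp (- (t * x)) * (cos x - 1 + x\<^sup>2 / 2)) \<partial>lborel) = ennreal (0 - F 0)"
    proof (rule nn_integral_FTC_atLeast[OF _ _ _ lim])
      fix x :: real
      \<comment> \<open>Naming the reciprocals keeps the derivative free of divisions by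
        \<open>t\<close>; the relations \<open>rv\<close> then collapse it to the integrand.\<close>
      define r v where "r = 1 / t" and "v = 1 / (1 + t\<^sup>2)"
      have rv: "t * r = 1" "(1 + t\<^sup>2) * v = 1"
        using t pos[of t] by (simp_all add: r_def v_def)
      have F: "F x = exp (- (t * x)) * ((sin x - t * cos x) * v + r - x\<^sup>2 * r / 2 - x * r\<^sup>2 - r ^ 3)" for x
        using t by (simp add: F_def r_def v_def power_divide)
      have "DERIV F x :> exp (- (t * x)) * (- t * ((sin x - t * cos x) * v + r - x\<^sup>2 * r / 2 - x * r\<^sup>2 - r ^ 3)
          + ((cos x + t * sin x) * v - x * r - r\<^sup>2))"
        unfolding F[abs_def]
        by (auto intro!: derivative_eq_intros simp: algebra_simps) (simp add: field_simps)
      also have "- t * ((sin x - t * cos x) * v + r - x\<^sup>2 * r / 2 - x * r\<^sup>2 - r ^ 3)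
          + ((cos x + t * sin x) * v - x * r - r\<^sup>2) =
          cos x * ((1 + t\<^sup>2) * v) - t * r + x\<^sup>2 * (t * r) / 2 + x * r * (t * r) + r\<^sup>2 * (t * r) - x * r - r\<^sup>2"
        by (simp add: algebra_simps power2_eq_square power3_eq_cube)
      also have "\<dots> = cos x - 1 + x\<^sup>2 / 2"
        unfolding rv by simp
      finally show "DERIV F x :> exp (- (t * x)) * (cos x - 1 + x\<^sup>2 / 2)" .
    qed (use nonneg in auto)
    also have "0 - F 0 = 1 / (t ^ 3 * (1 + t\<^sup>2))"
    proof -
      have "t \<noteq> 0" "1 + t\<^sup>2 \<noteq> 0"
        using t pos[of t] by simp_all
      then show ?thesis
        by (simp add: F_def divide_simps) (simp add: power2_eq_square power3_eq_cube algebra_simps)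
    qed
    finally show ?thesis
      by (simp only: nn_integral_Ici_eq_Ioi)
  qed
  have "((\<lambda>t. t powr (\<gamma> - 2 - 1) / (1 + t\<^sup>2)) has_integral pi / (2 * sin (pi * (\<gamma> - 2) / 2))) {0<..}"
    by (rule has_integral_powr_over_one_plus_square) (use assms in auto)
  \<comment> \<open>This sign change offsets the passage from \<open>1 - cos x\<close> to
    \<open>cos x - 1\<close>: the regularised cosine has the same constant in both ranges of
    \<gamma>.\<close>
  also have "sin (pi * (\<gamma> - 2) / 2) = - sin (pi * \<gamma> / 2)"
    using sin_periodic_pi[of "pi * (\<gamma> - 2) / 2"] by (simp add: algebra_simps diff_divide_distrib)
  finally have "((\<lambda>t. t powr (\<gamma> - 3) / (1 + t\<^sup>2)) has_integral - (pi / (2 * sin (pi * \<gamma> / 2)))) {0<..}"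
    by simp
  then show "((\<lambda>t. t powr \<gamma> * (1 / (t ^ 3 * (1 + t\<^sup>2)))) has_integral - (pi / (2 * sin (pi * \<gamma> / 2)))) {0<..}"
    by (rule has_integral_eq[rotated]) (auto simp: powr_diff)
qed (use assms in \<open>auto intro!: divide_nonneg_pos mult_pos_pos add_pos_nonneg\<close>)

section \<open>Homogeneous cosine kernels on the whole line\<close>

text \<open>Under scaling by \<open>|d|\<close> the weight contributes
  \<open>|d| powr (\<gamma> + 1)\<close> and the measure \<open>1 / |d|\<close>. Evenness doubles
  the half-line value and permits \<open>|d|\<close> in place of \<open>d\<close>.\<close>

lemma has_integral_UNIV_powr_dilate:
  fixes \<phi> :: "real \<Rightarrow> real"
  assumes abs: "(\<lambda>x. x powr (- \<gamma> - 1) * \<phi> x) absolutely_integrable_on {0<..}"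
    and int: "((\<lambda>x. x powr (- \<gamma> - 1) * \<phi> x) has_integral I) {0<..}"
    and even: "\<And>x. \<phi> (- x) = \<phi> x" and "d \<noteq> 0"
  shows "((\<lambda>x. \<bar>x\<bar> powr (- \<gamma> - 1) * \<phi> (d * x)) has_integral 2 * I * \<bar>d\<bar> powr \<gamma>) UNIV"
proof -
  define c where "c = \<bar>d\<bar>"
  have c: "c > 0" using \<open>d \<noteq> 0\<close> by (simp add: c_def)
  define f where "f x = \<bar>x\<bar> powr (- \<gamma> - 1) * \<phi> (c * x)" for x
  have f: "c powr (\<gamma> + 1) * ((c * x) powr (- \<gamma> - 1) * \<phi> (c * x)) = f x" if "x \<in> {0<..}" for x
  proof -
    have "c powr (\<gamma> + 1) * (c * x) powr (- \<gamma> - 1) = c powr ((\<gamma> + 1) + (- \<gamma> - 1)) * x powr (- \<gamma> - 1)"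
      using that c by (simp only: powr_add powr_mult)
    then show ?thesis
      using that c by (simp add: f_def mult.assoc[symmetric])
  qed
  note dil = has_integral_Ioi_dilate[OF abs int c]
  have "(\<lambda>x. c powr (\<gamma> + 1) * ((c * x) powr (- \<gamma> - 1) * \<phi> (c * x))) absolutely_integrable_on {0<..}"
    by (intro set_integrable_mult_right dil(1))
  then have f_abs: "f absolutely_integrable_on {0<..}"
    by (rule absolutely_integrable_spike[of _ _ "{}"]) (use f in auto)
  have "((\<lambda>x. c powr (\<gamma> + 1) * ((c * x) powr (- \<gamma> - 1) * \<phi> (c * x))) has_integral
      c powr (\<gamma> + 1) * (I / c)) {0<..}"
    by (intro has_integral_mult_right dil(2))
  then have "(f has_integral c powr (\<gamma> + 1) * (I / c)) {0<..}"
    by (rule has_integral_eq[rotated]) (use f in auto)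
  from has_integral_UNIV_even[OF f_abs this]
  have "(f has_integral 2 * (c powr (\<gamma> + 1) * (I / c))) UNIV"
    using even[of "c * _"] by (simp add: f_def)
  also have "2 * (c powr (\<gamma> + 1) * (I / c)) = 2 * I * c powr \<gamma>"
    using c by (simp add: powr_add)
  finally have "(f has_integral 2 * I * c powr \<gamma>) UNIV" .
  moreover have "\<phi> (c * x) = \<phi> (d * x)" for x
    using even[of "d * x"] by (simp add: c_def abs_if)
  ultimately show ?thesis
    by (simp add: f_def[abs_def] c_def)
qed

lemma has_integral_abs_powr_one_minus_cos:
  fixes \<gamma> d :: real
  assumes "0 < \<gamma>" "\<gamma> < 2"
  shows "((\<lambda>x. \<bar>x\<bar> powr (- \<gamma> - 1) * (1 - cos (d * x))) has_integral
    pi / (Gamma (\<gamma> + 1) * sin (pi * \<gamma> / 2)) * \<bar>d\<bar> powr \<gamma>) UNIV"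
\<comment> \<open>No dilation exists for \<open>d = 0\<close>, but then both sides vanish because
  \<open>0 powr \<gamma> = 0\<close>.\<close>
proof (cases "d = 0")
  case False
  note int = has_integral_powr_one_minus_cos[OF assms]
  have "(\<lambda>x. x powr (- \<gamma> - 1) * (1 - cos x)) absolutely_integrable_on {0<..}"
    by (rule nonnegative_absolutely_integrable_1) (use int in \<open>auto simp: integrable_on_def\<close>)
  from has_integral_UNIV_powr_dilate[OF this int _ False] show ?thesis
    by (simp add: mult.commute)
qed simp

lemma has_integral_abs_powr_cos_minus_Taylor:
  fixes \<gamma> d :: real
  assumes "2 < \<gamma>" "\<gamma> < 4"
  shows "((\<lambda>x. \<bar>x\<bar> powr (- \<gamma> - 1) * (cos (d * x) - 1 + (d * x)\<^sup>2 / 2)) has_integral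
    - pi / (Gamma (\<gamma> + 1) * sin (pi * \<gamma> / 2)) * \<bar>d\<bar> powr \<gamma>) UNIV"
proof (cases "d = 0")
  case False
  note int = has_integral_powr_cos_minus_Taylor[OF assms]
  have "0 \<le> cos x - 1 + x\<^sup>2 / 2" for x :: real
    using cos_ge_one_minus_half_square[of x] by simp
  then have "(\<lambda>x. x powr (- \<gamma> - 1) * (cos x - 1 + x\<^sup>2 / 2)) absolutely_integrable_on {0<..}"
    by (intro nonnegative_absolutely_integrable_1) (use int in \<open>auto simp: integrable_on_def\<close>)
  from has_integral_UNIV_powr_dilate[OF this int _ False] show ?thesis
    by (simp add: mult.commute)
qed simp

section \<open>The logarithmic case \<gamma> = 2\<close>

lemma has_integral_UNIV_reciprocal_annulus:
  fixes a b :: real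
  assumes "0 < a" "a \<le> b"
  shows "((\<lambda>x. if a \<le> \<bar>x\<bar> \<and> \<bar>x\<bar> < b then 1 / \<bar>x\<bar> else 0) has_integral 2 * (ln b - ln a)) UNIV"
proof -
  define f where "f x = (if a \<le> \<bar>x\<bar> \<and> \<bar>x\<bar> < b then 1 / \<bar>x\<bar> else 0)" for x
  have "((\<lambda>x. 1 / x) has_integral ln b - ln a) {a..b}"
    using assms
    by (intro fundamental_theorem_of_calculus)
       (auto intro!: derivative_eq_intros simp flip: has_real_derivative_iff_has_vector_derivative)
  then have "((\<lambda>x. if a \<le> x \<and> x < b then 1 / x else 0) has_integral ln b - ln a) {a..b}"
    by (rule has_integral_spike[of "{b}", rotated 2]) auto
  then have "((\<lambda>x. if a \<le> x \<and> x < b then 1 / x else 0) has_integral ln b - ln a) {0<..}"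
    by (rule has_integral_on_superset) (use assms in auto)
  then have f: "(f has_integral ln b - ln a) {0<..}"
    by (rule has_integral_eq[rotated]) (auto simp: f_def)
  have "f absolutely_integrable_on {0<..}"
    by (rule nonnegative_absolutely_integrable_1) (use f in \<open>auto simp: f_def integrable_on_def\<close>)
  from has_integral_UNIV_even[OF this f] show ?thesis
    by (simp add: f_def[abs_def])
qed

text \<open>The difference of cutoffs lives between the radii \<open>r\<close> and 1, with a sign
  that depends on which is larger; either way an annulus integral remains.\<close>

lemma has_integral_UNIV_reciprocal_cutoff:
  fixes r :: real
  assumes "r > 0"
  shows "((\<lambda>x. (of_bool (\<bar>x\<bar> < 1) - of_bool (\<bar>x\<bar> < r)) / \<bar>x\<bar>) has_integral - 2 * ln r) UNIV"
proof (cases "r \<le> 1")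
  case True
  from has_integral_UNIV_reciprocal_annulus[OF assms True] show ?thesis
    by (rule has_integral_eq[rotated, THEN has_integral_eq_rhs]) (use True in auto)
next
  case False
  then have "((\<lambda>x. - (if 1 \<le> \<bar>x\<bar> \<and> \<bar>x\<bar> < r then 1 / \<bar>x\<bar> else 0)) has_integral - (2 * (ln r - ln 1))) UNIV"
    by (intro has_integral_neg has_integral_UNIV_reciprocal_annulus) auto
  then show ?thesis
    by (rule has_integral_eq[rotated, THEN has_integral_eq_rhs]) (use False in auto)
qed

text \<open>Lagrange remainder of order 4; the cubic coefficient of the cosine is 0.\<close>

lemma abs_cos_minus_Taylor_le: "\<bar>cos x - 1 + x\<^sup>2 / 2\<bar> \<le> x ^ 4 / 24" for x :: real
proof -
  obtain t where "cos x = (\<Sum>m<4. cos_coeff m * x ^ m) + (cos (t + 1/2 * real 4 * pi) / fact 4) * x ^ 4"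
    using Maclaurin_cos_expansion[of x 4] by blast
  then have "cos x - 1 + x\<^sup>2 / 2 = cos (t + 2 * pi) / 24 * x ^ 4"
    by (simp add: lessThan_nat_numeral cos_coeff_def fact_numeral)
  also have "\<bar>\<dots>\<bar> = \<bar>cos t\<bar> * (x ^ 4 / 24)"
    by (simp add: abs_mult)
  also have "\<dots> \<le> 1 * (x ^ 4 / 24)"
    by (intro mult_right_mono) auto
  finally show ?thesis by simp
qed

text \<open>For \<open>\<gamma> = 2\<close> the quadratic Taylor term has to be cut off at infinity, and the cutoff is what
  breaks homogeneity: rescaling it produces the logarithm.\<close>

lemma has_integral_abs_powr_cos_cutoff:
  "\<exists>C :: real. \<forall>d. ((\<lambda>x. \<bar>x\<bar> powr (- 3) * (cos (d * x) - 1 + of_bool (\<bar>x\<bar> < 1) * (d * x)\<^sup>2 / 2)) has_integral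
      C * d\<^sup>2 + d\<^sup>2 * ln \<bar>d\<bar>) UNIV"
proof -
  \<comment> \<open>The cutoff is placed in the scaled variable, so dilation moves it to
    \<open>|d * x| < 1\<close>, away from the fixed cutoff of the claim.\<close>
  define \<phi> where "\<phi> x = cos x - 1 + of_bool (\<bar>x\<bar> < 1) * x\<^sup>2 / 2" for x :: real
  have abs: "(\<lambda>x. x powr (- 2 - 1) * \<phi> x) absolutely_integrable_on {0<..}"
  proof (rule absolutely_integrable_on_Ioi_powr_bound)
    show "(\<lambda>x. x powr (- 2 - 1) * \<phi> x) \<in> borel_measurable borel"
      unfolding \<phi>_def by measurable
    show "\<bar>x powr (- 2 - 1) * \<phi> x\<bar> \<le> (1 / 24) * x powr 1" if "0 < x" "x < 1" for x
    proof -
      have "\<bar>x powr (- 2 - 1) * \<phi> x\<bar> \<le> x powr - 3 * (x powr 4 / 24)"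
        using that abs_cos_minus_Taylor_le[of x] by (simp add: \<phi>_def abs_mult mult_left_mono)
      also have "\<dots> = (1 / 24) * x powr 1"
        by (simp add: powr_add[symmetric] del: powr_numeral)
      finally show ?thesis .
    qed
    show "\<bar>x powr (- 2 - 1) * \<phi> x\<bar> \<le> 2 * x powr (- 3)" if "1 \<le> x" for x
    proof -
      have "\<bar>\<phi> x\<bar> \<le> 2"
        using that abs_cos_le_one[of x] unfolding \<phi>_def by (simp; linarith)
      then show ?thesis
        using that by (simp add: abs_mult mult.commute mult_right_mono)
    qed
  qed auto
  define I where "I = integral {0<..} (\<lambda>x. x powr (- 2 - 1) * \<phi> x)"
  have int: "((\<lambda>x. x powr (- 2 - 1) * \<phi> x) has_integral I) {0<..}"
    using abs unfolding I_def by (intro integrable_integral set_lebesgue_integral_eq_integral(1))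
  have "((\<lambda>x. \<bar>x\<bar> powr (- 3) * (cos (d * x) - 1 + of_bool (\<bar>x\<bar> < 1) * (d * x)\<^sup>2 / 2)) has_integral
      2 * I * d\<^sup>2 + d\<^sup>2 * ln \<bar>d\<bar>) UNIV" for d
  proof (cases "d = 0")
    case False
    have "((\<lambda>x. \<bar>x\<bar> powr (- 2 - 1) * \<phi> (d * x)) has_integral 2 * I * \<bar>d\<bar> powr 2) UNIV"
      by (rule has_integral_UNIV_powr_dilate[OF abs int _ False]) (simp add: \<phi>_def)
    then have "((\<lambda>x. \<bar>x\<bar> powr (- 3) * \<phi> (d * x)) has_integral 2 * I * d\<^sup>2) UNIV"
      using False by simp
    \<comment> \<open>Correction between the cutoff radii \<open>1 / |d|\<close> and 1, where the
      quadratic term times the weight is \<open>d^2 / (2 * |x|)\<close>; its signed integral is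
      \<open>d^2 * ln |d|\<close>.\<close>
    moreover have "((\<lambda>x. d\<^sup>2 / 2 * ((of_bool (\<bar>x\<bar> < 1) - of_bool (\<bar>x\<bar> < 1 / \<bar>d\<bar>)) / \<bar>x\<bar>)) has_integral
        d\<^sup>2 / 2 * (- 2 * ln (1 / \<bar>d\<bar>))) UNIV"
      by (intro has_integral_mult_right has_integral_UNIV_reciprocal_cutoff) (use False in auto)
    ultimately have "((\<lambda>x. \<bar>x\<bar> powr (- 3) * \<phi> (d * x) +
        d\<^sup>2 / 2 * ((of_bool (\<bar>x\<bar> < 1) - of_bool (\<bar>x\<bar> < 1 / \<bar>d\<bar>)) / \<bar>x\<bar>)) has_integral
        2 * I * d\<^sup>2 + d\<^sup>2 / 2 * (- 2 * ln (1 / \<bar>d\<bar>))) UNIV"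
      by (rule has_integral_add)
    also have "d\<^sup>2 / 2 * (- 2 * ln (1 / \<bar>d\<bar>)) = d\<^sup>2 * ln \<bar>d\<bar>"
      using False by (simp add: ln_div)
    finally show ?thesis
    proof (rule has_integral_eq[rotated])
      fix x :: real
      show "\<bar>x\<bar> powr (- 3) * \<phi> (d * x) + d\<^sup>2 / 2 * ((of_bool (\<bar>x\<bar> < 1) - of_bool (\<bar>x\<bar> < 1 / \<bar>d\<bar>)) / \<bar>x\<bar>) =
        \<bar>x\<bar> powr (- 3) * (cos (d * x) - 1 + of_bool (\<bar>x\<bar> < 1) * (d * x)\<^sup>2 / 2)"
      \<comment> \<open>At 0 both sides vanish, as \<open>0 powr (- 3)\<close> and division by 0 are
        0.\<close>
      proof (cases "x = 0")
        case nz: False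
        have "\<bar>x\<bar> powr (- 3) * x\<^sup>2 = \<bar>x\<bar> powr (- 3) * \<bar>x\<bar> powr 2"
          using nz by simp
        also have "\<dots> = \<bar>x\<bar> powr (- 1)"
          by (simp only: powr_add[symmetric]) simp
        also have "\<dots> = 1 / \<bar>x\<bar>"
          using nz by (simp add: powr_minus_divide)
        finally have *: "1 / \<bar>x\<bar> = \<bar>x\<bar> powr (- 3) * x\<^sup>2" by simp
        have "\<bar>d * x\<bar> < 1 \<longleftrightarrow> \<bar>x\<bar> < 1 / \<bar>d\<bar>"
          using False by (simp add: abs_mult field_simps)
        moreover have "u / \<bar>x\<bar> = u * (\<bar>x\<bar> powr (- 3) * x\<^sup>2)" for u
          unfolding *[symmetric] by simp
        ultimately show ?thesis
          by (simp add: \<phi>_def algebra_simps power_mult_distrib)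
      qed simp
    qed
  qed simp
  then show ?thesis
    by blast
qed

section \<open>The odd part: sine kernels\<close>

text \<open>Oddness gives 0 once absolute integrability is known. Removing the linear term near 0
  leaves a cubic remainder, integrable for \<gamma> < 3; the cutoff preserves the decay at
  infinity.\<close>

lemma has_integral_abs_powr_sin_cutoff:
  fixes \<gamma> d :: real
  assumes "0 < \<gamma>" "\<gamma> < 3"
  shows "((\<lambda>x. \<bar>x\<bar> powr (- \<gamma> - 1) * (sin (d * x) - of_bool (\<bar>x\<bar> < 1) * (d * x))) has_integral 0) UNIV"
proof (rule has_integral_UNIV_odd)
  let ?f = "\<lambda>x. \<bar>x\<bar> powr (- \<gamma> - 1) * (sin (d * x) - of_bool (\<bar>x\<bar> < 1) * (d * x))"
  show "?f absolutely_integrable_on {0<..}"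
  proof (rule absolutely_integrable_on_Ioi_powr_bound)
    show "?f \<in> borel_measurable borel"
      by measurable
    show "\<bar>?f x\<bar> \<le> (\<bar>d\<bar> ^ 3 / 6) * x powr (2 - \<gamma>)" if "0 < x" "x < 1" for x
    proof -
      have "\<bar>sin (d * x) - d * x\<bar> \<le> \<bar>d * x\<bar> ^ 3 / 6"
        using Maclaurin_sin_bound[of "d * x" 3]
        by (simp add: eval_nat_numeral sin_coeff_def)
      then have "\<bar>?f x\<bar> \<le> x powr (- \<gamma> - 1) * (\<bar>d * x\<bar> ^ 3 / 6)"
        using that by (simp add: abs_mult mult_left_mono)
      also have "\<dots> = (\<bar>d\<bar> ^ 3 / 6) * (x powr (- \<gamma> - 1) * x powr 3)"
        using that by (simp add: abs_mult power_mult_distrib)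
      also have "\<dots> = (\<bar>d\<bar> ^ 3 / 6) * x powr (2 - \<gamma>)"
        by (simp add: powr_add[symmetric] del: powr_numeral)
      finally show ?thesis .
    qed
    show "\<bar>?f x\<bar> \<le> 1 * x powr (- \<gamma> - 1)" if "1 \<le> x" for x
      using that by (simp add: abs_mult mult_left_le)
  qed (use assms in auto)
qed (simp add: algebra_simps)

section \<open>Fourier transform of a hat function\<close>

text \<open>Integration by parts: the antiderivative \<open>G\<close> separates the value of the
  affine function, over \<xi>, from its slope, over \<open>\<xi>^2\<close>.\<close>

lemma has_integral_affine_mult_exp:
  fixes \<alpha> \<beta> \<xi> u v :: real
  assumes "\<xi> \<noteq> 0" "u \<le> v"
  defines "G \<equiv> \<lambda>t. exp (- \<i> * complex_of_real (t * \<xi>)) * (of_real (\<alpha> * t + \<beta>) * \<i> / \<xi> + \<alpha> / \<xi>\<^sup>2)"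
  shows "((\<lambda>t. complex_of_real (\<alpha> * t + \<beta>) * exp (- \<i> * complex_of_real (t * \<xi>))) has_integral G v - G u) {u..v}"
proof (rule fundamental_theorem_of_calculus[OF assms(2)])
  fix t assume "t \<in> {u..v}"
  have "((\<lambda>z. exp (- \<i> * (z * of_real \<xi>)) * ((of_real \<alpha> * z + of_real \<beta>) * \<i> / of_real \<xi> + of_real \<alpha> / (of_real \<xi>)\<^sup>2))
     has_field_derivative of_real (\<alpha> * t + \<beta>) * exp (- \<i> * of_real (t * \<xi>))) (at (of_real t))"
    using assms(1) by (auto intro!: derivative_eq_intros) (simp add: field_simps power2_eq_square)
  from has_vector_derivative_real_field[OF this]
  show "(G has_vector_derivative of_real (\<alpha> * t + \<beta>) * exp (- \<i> * of_real (t * \<xi>))) (at t within {u..v})"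
    by (simp add: G_def)
qed

text \<open>The two affine pieces agree at the middle node and vanish at the outer ones, so the
  value terms cancel. What remains over \<open>\<xi>^2\<close> are the slope jumps at the three
  nodes, which are the weights \<open>cvec x j\<close>.\<close>

lemma fourier_hat:
  assumes "1 \<le> j" "x (j - 1) < x j" "x j < x (j + 1)" "\<xi> \<noteq> 0"
  shows "fourier (hat x j) \<xi> = - 1 / (sqrt (2 * pi) * \<xi>\<^sup>2) *
    (\<Sum>p\<in>{-1,0,1}. of_real (cvec x j p) * cis (- (x (nat (int j + p)) * \<xi>)))"
proof -
  define a b c where "a = x (j - 1)" and "b = x j" and "c = x (j + 1)"
  have abc: "a < b" "b < c"
    using assms by (simp_all add: a_def b_def c_def)
  have mesh: "mesh x j = b - a" "mesh x (j + 1) = c - b"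
    by (simp_all add: mesh_def a_def b_def c_def)
  have nodes: "x (nat (int j + (-1))) = a" "x (nat (int j + 0)) = b" "x (nat (int j + 1)) = c"
    using assms(1) by (simp_all add: a_def b_def c_def nat_diff_distrib nat_add_distrib)
  define E where "E t = exp (- \<i> * complex_of_real (t * \<xi>))" for t
  define \<alpha> \<alpha>' where "\<alpha> = 1 / (b - a)" and "\<alpha>' = 1 / (c - b)"
  define f where "f t = complex_of_real (\<alpha> * t + - \<alpha> * a) * E t" for t
  define g where "g t = complex_of_real (- \<alpha>' * t + \<alpha>' * c) * E t" for t
  define V where "V = - 1 / \<xi>\<^sup>2 * (\<alpha> * E a + (- \<alpha> - \<alpha>') * E b + \<alpha>' * E c)"
  define A where "A = E b * (of_real (\<alpha> * b + - \<alpha> * a) * \<i> / \<xi> + \<alpha> / \<xi>\<^sup>2) -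
    E a * (of_real (\<alpha> * a + - \<alpha> * a) * \<i> / \<xi> + \<alpha> / \<xi>\<^sup>2)"
  define B where "B = E c * (of_real (- \<alpha>' * c + \<alpha>' * c) * \<i> / \<xi> + (- \<alpha>') / \<xi>\<^sup>2) -
    E b * (of_real (- \<alpha>' * b + \<alpha>' * c) * \<i> / \<xi> + (- \<alpha>') / \<xi>\<^sup>2)"
  have "(f has_integral A) {a..b}" "(g has_integral B) {b..c}"
    unfolding f_def g_def A_def B_def E_def
    by (rule has_integral_affine_mult_exp; use abc assms in simp)+
  then have "((\<lambda>t. (if t \<in> {a..b} then f t else 0) + (if t \<in> {b..c} then g t else 0)) has_integral A + B) UNIV"
    by (intro has_integral_add) (simp_all only: has_integral_restrict_UNIV)
  then have "((\<lambda>t. complex_of_real (hat x j t) * E t) has_integral A + B) UNIV"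
  \<comment> \<open>At the peak \<open>b\<close> the strict inequalities make \<open>hat\<close>
    equal to 0, while both closed pieces contribute there; hence the nodes are excluded as a null
    set.\<close>
  proof (rule has_integral_spike[of "{a, b, c}", rotated 2])
    fix t assume t: "t \<in> UNIV - {a, b, c}"
    have "(t - a) / (b - a) = \<alpha> * t + - \<alpha> * a" "(c - t) / (c - b) = - \<alpha>' * t + \<alpha>' * c"
      by (simp_all add: \<alpha>_def \<alpha>'_def diff_divide_distrib)
    then show "complex_of_real (hat x j t) * E t =
        (if t \<in> {a..b} then f t else 0) + (if t \<in> {b..c} then g t else 0)"
      using abc t unfolding hat_def mesh a_def[symmetric] b_def[symmetric] c_def[symmetric] f_def g_def
      by auto
  qed simp
  moreover have "A + B = V"
  proof -
    \<comment> \<open>Both pieces take the value 1 at \<open>b\<close>, which cancels the terms in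
      \<open>\<i> / \<xi>\<close>.\<close>
    have "\<alpha> * b + - \<alpha> * a = 1" "- \<alpha>' * b + \<alpha>' * c = 1"
      using abc unfolding \<alpha>_def \<alpha>'_def by (simp_all add: diff_divide_distrib[symmetric])
    then show ?thesis
      unfolding A_def B_def V_def using assms(4) by (simp add: field_simps)
  qed
  ultimately have "integral UNIV (\<lambda>t. complex_of_real (hat x j t) * E t) = V"
    by (simp add: integral_unique)
  moreover have "E t = cis (- (t * \<xi>))" for t
    by (simp add: E_def cis_conv_exp)
  ultimately show ?thesis
    unfolding fourier_def E_def[symmetric]
    by (simp add: V_def nodes[simplified] cvec_def mesh[simplified] \<alpha>_def \<alpha>'_def)
qed

section \<open>Vanishing moments of the weights\<close>

text \<open>The weights form a difference of two adjacent difference quotients: constants give 0 - 0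
  and the identity gives 1 - 1.\<close>

lemma sum_cvec:
  assumes "1 \<le> j" "x (j - 1) < x j" "x j < x (j + 1)"
  shows "(\<Sum>p\<in>{-1,0,1}. cvec x j p) = 0"
    and "(\<Sum>p\<in>{-1,0,1}. cvec x j p * x (nat (int j + p))) = 0"
proof -
  show "(\<Sum>p\<in>{-1,0,1}. cvec x j p) = 0"
    by (simp add: cvec_def)
  have "nat (int j - 1) = j - 1" "nat (int j + 1) = Suc j"
    using assms(1) by (simp_all add: nat_diff_distrib nat_add_distrib)
  then have "(\<Sum>p\<in>{-1,0,1}. cvec x j p * x (nat (int j + p))) =
      (x (j - 1) - x j) / mesh x j + (x (j + 1) - x j) / mesh x (j + 1)"
    by (simp add: cvec_def diff_divide_distrib algebra_simps)
  also have "\<dots> = 0"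
    using assms by (simp add: mesh_def divide_simps)
  finally show "(\<Sum>p\<in>{-1,0,1}. cvec x j p * x (nat (int j + p))) = 0" .
qed

text \<open>Corrections quadratic in \<open>d\<close>, which make the individual kernels integrable, cancel in the double
  sum because the weights annihilate affine functions.\<close>

lemma has_integral_double_sum_moments:
  fixes c e y z :: "'i \<Rightarrow> real"
  assumes "finite P" "finite Q"
    and c: "(\<Sum>p\<in>P. c p) = 0" "(\<Sum>p\<in>P. c p * y p) = 0"
    and e: "(\<Sum>q\<in>Q. e q) = 0" "(\<Sum>q\<in>Q. e q * z q) = 0"
    and int: "\<And>d. ((\<lambda>\<xi>. K \<xi> * (\<phi> (d * \<xi>) + (b0 \<xi> + b1 \<xi> * d + b2 \<xi> * d\<^sup>2))) has_integral \<kappa> * m d + C * d\<^sup>2) UNIV"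
  shows "((\<lambda>\<xi>. K \<xi> * (\<Sum>p\<in>P. \<Sum>q\<in>Q. c p * e q * \<phi> ((y p - z q) * \<xi>))) has_integral
    \<kappa> * (\<Sum>p\<in>P. \<Sum>q\<in>Q. c p * e q * m (y p - z q))) UNIV"
proof -
  \<comment> \<open>The regrouping gives every term a factor \<open>c p\<close>, \<open>e q\<close>
    or \<open>e q * z q\<close> whose sum is 0. It is applied pointwise in \<xi> to the corrections
    \<open>b0\<close>, \<open>b1\<close>, \<open>b2\<close>, and once to the term with
    \<open>C\<close>.\<close>
  have cancel: "(\<Sum>p\<in>P. \<Sum>q\<in>Q. c p * e q * (u + v * (y p - z q) + w * (y p - z q)\<^sup>2)) = 0" for u v w
  proof -
    have "(\<Sum>p\<in>P. \<Sum>q\<in>Q. c p * e q * (u + v * (y p - z q) + w * (y p - z q)\<^sup>2)) =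
      (\<Sum>p\<in>P. \<Sum>q\<in>Q. (c p * (u + v * y p + w * (y p)\<^sup>2)) * e q + (- v * c p - 2 * w * (c p * y p)) * (e q * z q)
        + c p * (w * (e q * (z q)\<^sup>2)))"
      by (intro sum.cong refl) (simp add: algebra_simps power2_eq_square)
    also have "\<dots> = (\<Sum>p\<in>P. c p * (u + v * y p + w * (y p)\<^sup>2)) * (\<Sum>q\<in>Q. e q) +
      (\<Sum>p\<in>P. - v * c p - 2 * w * (c p * y p)) * (\<Sum>q\<in>Q. e q * z q) +
      (\<Sum>p\<in>P. c p) * (\<Sum>q\<in>Q. w * (e q * (z q)\<^sup>2))"
      by (simp only: sum.distrib sum_product)
    finally show ?thesis
      using c e by simp
  qed
  have "((\<lambda>\<xi>. \<Sum>p\<in>P. \<Sum>q\<in>Q. c p * e q * (K \<xi> * (\<phi> ((y p - z q) * \<xi>) +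
      (b0 \<xi> + b1 \<xi> * (y p - z q) + b2 \<xi> * (y p - z q)\<^sup>2)))) has_integral
      (\<Sum>p\<in>P. \<Sum>q\<in>Q. c p * e q * (\<kappa> * m (y p - z q) + C * (y p - z q)\<^sup>2))) UNIV"
    by (intro has_integral_sum has_integral_mult_right int assms)
  also have "(\<Sum>p\<in>P. \<Sum>q\<in>Q. c p * e q * (\<kappa> * m (y p - z q) + C * (y p - z q)\<^sup>2)) =
      \<kappa> * (\<Sum>p\<in>P. \<Sum>q\<in>Q. c p * e q * m (y p - z q)) +
      (\<Sum>p\<in>P. \<Sum>q\<in>Q. c p * e q * (0 + 0 * (y p - z q) + C * (y p - z q)\<^sup>2))"
    by (simp add: sum.distrib sum_distrib_left algebra_simps)
  also have "(\<lambda>\<xi>. \<Sum>p\<in>P. \<Sum>q\<in>Q. c p * e q * (K \<xi> * (\<phi> ((y p - z q) * \<xi>) +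
      (b0 \<xi> + b1 \<xi> * (y p - z q) + b2 \<xi> * (y p - z q)\<^sup>2)))) =
    (\<lambda>\<xi>. K \<xi> * (\<Sum>p\<in>P. \<Sum>q\<in>Q. c p * e q * \<phi> ((y p - z q) * \<xi>)) +
      K \<xi> * (\<Sum>p\<in>P. \<Sum>q\<in>Q. c p * e q * (b0 \<xi> + b1 \<xi> * (y p - z q) + b2 \<xi> * (y p - z q)\<^sup>2)))"
    unfolding sum_distrib_left sum.distrib[symmetric]
    by (intro ext sum.cong refl) (simp only: algebra_simps)
  finally show ?thesis
    unfolding cancel by simp
qed

section \<open>Assembly of the stiffness entries\<close>

locale hat_pair =
  fixes x :: "nat \<Rightarrow> real" and j k :: nat and s :: real
  assumes j: "1 \<le> j" "x (j - 1) < x j" "x j < x (j + 1)"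
    and k: "1 \<le> k" "x (k - 1) < x k" "x k < x (k + 1)"
    and s: "0 < s" "s < 3 / 2"
begin

text \<open>The bilinear form of the weights as a functional of a kernel in the node difference;
  cosine, sine and the final matrix entries are all instances.\<close>

definition node_sum :: "(real \<Rightarrow> real) \<Rightarrow> real" where
  "node_sum m = (\<Sum>p\<in>{-1,0,1}. \<Sum>q\<in>{-1,0,1}. cvec x j p * cvec x k q *
    m (x (nat (int j + p)) - x (nat (int k + q))))"

lemma has_integral_node_sum:
  assumes "\<And>d. ((\<lambda>\<xi>. K \<xi> * (\<phi> (d * \<xi>) + (b0 \<xi> + b1 \<xi> * d + b2 \<xi> * d\<^sup>2))) has_integral \<kappa> * m d + C * d\<^sup>2) UNIV"
  shows "((\<lambda>\<xi>. K \<xi> * node_sum (\<lambda>d. \<phi> (d * \<xi>))) has_integral \<kappa> * node_sum m) UNIV"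
  unfolding node_sum_def
  by (rule has_integral_double_sum_moments[OF _ _ sum_cvec[OF j] sum_cvec[OF k] assms]) auto

text \<open>Conjugating the second transform flips its phases, so node differences appear; the two
  factors \<open>1 / \<xi>^2\<close> lower the weight exponent to \<open>2 * s - 4\<close>.\<close>

lemma stiff_integrand_eq:
  assumes "\<xi> \<noteq> 0"
  shows "stiff_integrand s x j k \<xi> =
    of_real (1 / (2 * pi) * (\<bar>\<xi>\<bar> powr (2 * s - 4) * node_sum (\<lambda>d. cos (d * \<xi>)))) -
    \<i> * of_real (1 / (2 * pi) * (\<bar>\<xi>\<bar> powr (2 * s - 4) * node_sum (\<lambda>d. sin (d * \<xi>))))"
proof -
  have "stiff_integrand s x j k \<xi> = of_real (\<bar>\<xi>\<bar> powr (2 * s)) *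
    (- 1 / (sqrt (2 * pi) * \<xi>\<^sup>2) * (\<Sum>p\<in>{-1,0,1}. of_real (cvec x j p) * cis (- (x (nat (int j + p)) * \<xi>)))) *
    (- 1 / (sqrt (2 * pi) * \<xi>\<^sup>2) * (\<Sum>q\<in>{-1,0,1}. of_real (cvec x k q) * cis (x (nat (int k + q)) * \<xi>)))"
    unfolding stiff_integrand_def fourier_hat[OF j assms] fourier_hat[OF k assms] by (simp add: cis_cnj)
  also have "\<dots> = complex_of_real (\<bar>\<xi>\<bar> powr (2 * s) * (1 / (sqrt (2 * pi) * \<xi>\<^sup>2))\<^sup>2) *
    ((\<Sum>p\<in>{-1,0,1}. of_real (cvec x j p) * cis (- (x (nat (int j + p)) * \<xi>))) *
     (\<Sum>q\<in>{-1,0,1}. of_real (cvec x k q) * cis (x (nat (int k + q)) * \<xi>)))"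
  proof -
    have "of_real r * (of_real (- 1 / t) * A) * (of_real (- 1 / t) * B) = of_real (r * (1 / t)\<^sup>2) * (A * B)"
      for r t :: real and A B :: complex
      by (simp add: power2_eq_square)
    then show ?thesis .
  qed
  also have "\<bar>\<xi>\<bar> powr (2 * s) * (1 / (sqrt (2 * pi) * \<xi>\<^sup>2))\<^sup>2 = 1 / (2 * pi) * \<bar>\<xi>\<bar> powr (2 * s - 4)"
    using assms by (simp add: powr_diff power_mult_distrib power_divide power_mult[symmetric])
  also have "(\<Sum>p\<in>{-1,0,1}. of_real (cvec x j p) * cis (- (x (nat (int j + p)) * \<xi>))) *
     (\<Sum>q\<in>{-1,0,1}. of_real (cvec x k q) * cis (x (nat (int k + q)) * \<xi>)) =
     of_real (node_sum (\<lambda>d. cos (d * \<xi>))) - \<i> * of_real (node_sum (\<lambda>d. sin (d * \<xi>)))"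
  proof -
    have "(of_real c * cis (- (y * \<xi>))) * (of_real e * cis (z * \<xi>)) =
      of_real (c * e * cos ((y - z) * \<xi>)) - \<i> * of_real (c * e * sin ((y - z) * \<xi>))" for c e y z
    proof -
      have "(of_real c * cis (- (y * \<xi>))) * (of_real e * cis (z * \<xi>)) = of_real (c * e) * cis (- ((y - z) * \<xi>))"
        by (simp add: cis_mult algebra_simps)
      also have "\<dots> = of_real (c * e * cos ((y - z) * \<xi>)) - \<i> * of_real (c * e * sin ((y - z) * \<xi>))"
        by (simp add: complex_eq_iff)
      finally show ?thesis .
    qed
    then show ?thesis
      unfolding sum_product
      by (simp only: node_sum_def of_real_sum sum_distrib_left sum_subtractf)
  qed
  finally show ?thesis
    by (simp add: algebra_simps)
qed

text \<open>Reduces each case to one regularised cosine integral for every \<open>d\<close>, whose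
  value matters only modulo multiples of \<open>d^2\<close>. The imaginary part integrates to
  0.\<close>

lemma has_integral_stiff_integrand:
  assumes "\<And>d. ((\<lambda>\<xi>. \<bar>\<xi>\<bar> powr (2 * s - 4) * (cos (d * \<xi>) + (b0 \<xi> + b1 \<xi> * d + b2 \<xi> * d\<^sup>2))) has_integral
    \<kappa> * m d + C * d\<^sup>2) UNIV"
  shows "(stiff_integrand s x j k has_integral of_real (\<kappa> / (2 * pi) * node_sum m)) UNIV"
proof -
  let ?w = "\<lambda>\<xi>. \<bar>\<xi>\<bar> powr (2 * s - 4)"
  have "((\<lambda>\<xi>. ?w \<xi> * node_sum (\<lambda>d. cos (d * \<xi>))) has_integral \<kappa> * node_sum m) UNIV"
    by (rule has_integral_node_sum[OF assms])
  \<comment> \<open>The cut-off linear term of the sine is an admissible correction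
    \<open>b1\<close>, and the target kernel is zero.\<close>
  moreover have "((\<lambda>\<xi>. ?w \<xi> * node_sum (\<lambda>d. sin (d * \<xi>))) has_integral 0 * node_sum (\<lambda>_. 0)) UNIV"
  proof (rule has_integral_node_sum)
    fix d
    have "((\<lambda>\<xi>. \<bar>\<xi>\<bar> powr (- (3 - 2 * s) - 1) * (sin (d * \<xi>) - of_bool (\<bar>\<xi>\<bar> < 1) * (d * \<xi>))) has_integral 0) UNIV"
      by (rule has_integral_abs_powr_sin_cutoff) (use s in auto)
    then show "((\<lambda>\<xi>. ?w \<xi> * (sin (d * \<xi>) + (0 + - (of_bool (\<bar>\<xi>\<bar> < 1) * \<xi>) * d + 0 * d\<^sup>2))) has_integral
        0 * 0 + 0 * d\<^sup>2) UNIV"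
      by (simp add: algebra_simps)
  qed
  ultimately have "((\<lambda>\<xi>. complex_of_real (1 / (2 * pi) * (?w \<xi> * node_sum (\<lambda>d. cos (d * \<xi>)))) -
      \<i> * of_real (1 / (2 * pi) * (?w \<xi> * node_sum (\<lambda>d. sin (d * \<xi>))))) has_integral
      of_real (1 / (2 * pi) * (\<kappa> * node_sum m)) - \<i> * of_real (1 / (2 * pi) * (0 * node_sum (\<lambda>_. 0)))) UNIV"
    by (intro has_integral_diff has_integral_mult_right has_integral_of_real)
  then have "(stiff_integrand s x j k has_integral
      of_real (1 / (2 * pi) * (\<kappa> * node_sum m)) - \<i> * of_real (1 / (2 * pi) * (0 * node_sum (\<lambda>_. 0)))) UNIV"
    by (rule has_integral_spike[of "{0}", rotated 2]) (use stiff_integrand_eq in auto)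
  then show ?thesis
    by simp
qed

lemma node_sum_eq_cMc: "node_sum m = cMc x j k (\<lambda>p q. m (x (nat (int j + p)) - x (nat (int k + q))))"
  unfolding node_sum_def cMc_def by (intro sum.cong refl) (simp only: mult_ac)

text \<open>Below \<gamma> = 2 a constant correction suffices, above it a quadratic one is added;
  both give the same \<kappa>.\<close>

lemma has_integral_stiff_integrand_power:
  assumes "s \<noteq> 1 / 2"
  shows "(stiff_integrand s x j k has_integral of_real (Chat s * cMc x j k (Dmat x (3 - 2 * s) j k))) UNIV"
proof -
  define \<gamma> where "\<gamma> = 3 - 2 * s"
  define \<kappa> where "\<kappa> = - pi / (Gamma (\<gamma> + 1) * sin (pi * \<gamma> / 2))"
  have \<gamma>: "- \<gamma> - 1 = 2 * s - 4" "0 < \<gamma>" "\<gamma> < 3" "\<gamma> \<noteq> 2"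
    using s assms by (auto simp: \<gamma>_def)
  \<comment> \<open>The angle is \<open>3 * pi / 2 - s * pi\<close>, the source of the cosine in
    \<open>Chat\<close>.\<close>
  have "sin (pi * \<gamma> / 2) = - cos (s * pi)"
  proof -
    have "pi * \<gamma> / 2 = (pi / 2 - s * pi) + pi"
      by (simp add: \<gamma>_def field_simps)
    then show ?thesis
      by (simp only: sin_periodic_pi) (simp add: sin_diff)
  qed
  then have \<kappa>: "\<kappa> / (2 * pi) = Chat s"
    by (simp add: \<kappa>_def Chat_def \<gamma>_def)
  have "(stiff_integrand s x j k has_integral of_real (\<kappa> / (2 * pi) * node_sum (\<lambda>d. \<bar>d\<bar> powr \<gamma>))) UNIV"
  proof (cases "\<gamma> < 2")
    case True
    show ?thesis
    proof (rule has_integral_stiff_integrand)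
      fix d
      have "((\<lambda>\<xi>. - (\<bar>\<xi>\<bar> powr (- \<gamma> - 1) * (1 - cos (d * \<xi>)))) has_integral
          - (pi / (Gamma (\<gamma> + 1) * sin (pi * \<gamma> / 2)) * \<bar>d\<bar> powr \<gamma>)) UNIV"
        by (intro has_integral_neg has_integral_abs_powr_one_minus_cos \<gamma> True)
      then show "((\<lambda>\<xi>. \<bar>\<xi>\<bar> powr (2 * s - 4) * (cos (d * \<xi>) + (-1 + 0 * d + 0 * d\<^sup>2))) has_integral
          \<kappa> * \<bar>d\<bar> powr \<gamma> + 0 * d\<^sup>2) UNIV"
        by (simp add: \<gamma>(1) \<kappa>_def algebra_simps)
    qed
  next
    case False
    show ?thesis
    proof (rule has_integral_stiff_integrand)
      fix d
      have "((\<lambda>\<xi>. \<bar>\<xi>\<bar> powr (- \<gamma> - 1) * (cos (d * \<xi>) - 1 + (d * \<xi>)\<^sup>2 / 2)) has_integral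
          - pi / (Gamma (\<gamma> + 1) * sin (pi * \<gamma> / 2)) * \<bar>d\<bar> powr \<gamma>) UNIV"
        by (rule has_integral_abs_powr_cos_minus_Taylor) (use False \<gamma> in auto)
      then show "((\<lambda>\<xi>. \<bar>\<xi>\<bar> powr (2 * s - 4) * (cos (d * \<xi>) + (-1 + 0 * d + \<xi>\<^sup>2 / 2 * d\<^sup>2))) has_integral
          \<kappa> * \<bar>d\<bar> powr \<gamma> + 0 * d\<^sup>2) UNIV"
        by (simp add: \<gamma>(1) \<kappa>_def algebra_simps power_mult_distrib)
    qed
  qed
  then show ?thesis
    unfolding \<kappa> node_sum_eq_cMc by (simp add: Dmat_def[abs_def] dist_nodes_def \<gamma>_def)
qed

text \<open>The constant \<open>C\<close> is never evaluated: it multiplies \<open>d^2\<close>,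
  which the moments annihilate, so only the logarithm survives.\<close>

lemma has_integral_stiff_integrand_log:
  assumes "s = 1 / 2"
  shows "(stiff_integrand s x j k has_integral of_real (1 / (2 * pi) * cMc x j k (Emat x j k))) UNIV"
proof -
  obtain C :: real where C:
    "\<forall>d. ((\<lambda>\<xi>. \<bar>\<xi>\<bar> powr (- 3) * (cos (d * \<xi>) - 1 + of_bool (\<bar>\<xi>\<bar> < 1) * (d * \<xi>)\<^sup>2 / 2)) has_integral
      C * d\<^sup>2 + d\<^sup>2 * ln \<bar>d\<bar>) UNIV"
    using has_integral_abs_powr_cos_cutoff by blast
  have "(stiff_integrand s x j k has_integral of_real (1 / (2 * pi) * node_sum (\<lambda>d. d\<^sup>2 * ln \<bar>d\<bar>))) UNIV"
  proof (rule has_integral_stiff_integrand)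
    fix d
    show "((\<lambda>\<xi>. \<bar>\<xi>\<bar> powr (2 * s - 4) * (cos (d * \<xi>) + (-1 + 0 * d + of_bool (\<bar>\<xi>\<bar> < 1) * \<xi>\<^sup>2 / 2 * d\<^sup>2))) has_integral
        1 * (d\<^sup>2 * ln \<bar>d\<bar>) + C * d\<^sup>2) UNIV"
      using C[rule_format, of d] by (simp add: assms algebra_simps power_mult_distrib)
  qed
  \<comment> \<open>At \<open>d = 0\<close> the factor \<open>d^2\<close> yields the value 0
    prescribed by \<open>Emat\<close>.\<close>
  also have "node_sum (\<lambda>d. d\<^sup>2 * ln \<bar>d\<bar>) = cMc x j k (Emat x j k)"
    unfolding node_sum_eq_cMc cMc_def by (intro sum.cong refl) (simp add: Emat_def dist_nodes_def Let_def)
  finally show ?thesis .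
qed

end

theorem theorem2p1:
  fixes a b s :: real and N j k :: nat and x :: "nat \<Rightarrow> real"
  assumes "a < b" and "N \<ge> 2"
    and "x 0 = a" and "x N = b"
    and "\<forall>l<N. x l < x (Suc l)"
    and "0 < s" and "s < 3/2"
    and "1 \<le> j" and "j \<le> N - 1" and "1 \<le> k" and "k \<le> N - 1"
  shows "(s \<noteq> 1/2 \<longrightarrow>
           (stiff_integrand s x j k has_integral
              complex_of_real (Chat s * cMc x j k (Dmat x (3 - 2 * s) j k))) UNIV)
       \<and> (s = 1/2 \<longrightarrow>
           (stiff_integrand s x j k has_integral
              complex_of_real (1 / (2 * pi) * cMc x j k (Emat x j k))) UNIV)"
proof -
  \<comment> \<open>For interior \<open>l\<close> both \<open>l - 1\<close> and \<open>l\<close> are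
    below \<open>N\<close>, so the partition is increasing on either side of node
    \<open>l\<close>.\<close>
  have "x (l - 1) < x l \<and> x l < x (l + 1)" if "1 \<le> l" "l \<le> N - 1" for l
    using assms(5)[rule_format, of "l - 1"] assms(5)[rule_format, of l] assms(2) that by simp
  then interpret hat_pair x j k s
    by unfold_locales (use assms in auto)
  show ?thesis
    using has_integral_stiff_integrand_power has_integral_stiff_integrand_log by blast
qed

end
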